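(* Let $\{x_k\}_{k\ge1}$ be generated by the projected subgradient method with initial point $x_1\in\mathcal{T}_{1/2}$ and constant step-size $\alpha_k=\alpha$ satisfying $$0<\alpha<\min\left\{1,\ \min\Big\{1,\frac{\mu}{L}\Big\}\Big(\frac{\mu}{2\rho}\Big)^{\frac1{\delta(1+\nu)-1}}\right\}.$$ Then, with $f_k^*:=\min\{f(x_i):i=1,\dots,k\}$, $$0\le f_k^*-f^*\le2L\alpha\qquad\text{for all integers }k\ge\frac1{\alpha^2}\Big(\frac{\mu}{2\rho}\Big)^{\frac{2\delta}{\delta(1+\nu)-1}}.$$
   Context: $\|\cdot\|$ is the Euclidean norm on $\mathbb{R}^n$, $\operatorname{dist}(x;S)=\inf_{z\in S}\|z-x\|$, $\operatorname{proj}_X$ is the Euclidean projection onto $X$, $\operatorname{dom}(f)=\{x:f(x)<+\infty\}$, and $\partial f$ is the Clarke subdifferential. Standing assumptions: $f:\mathbb{R}^n\to\mathbb{R}\cup\{+\infty\}$ is proper; $X\subseteq\operatorname{dom}(f)$ is nonempty, closed and convex; the set of minimizers $\mathcal{X}^*=\operatorname{argmin}_{x\in X}f(x)$ is nonempty and $f^*$ is the minimal value of $f$ over $X$. The parameters satisfy $\rho>0$, $0<\nu\le1$, $\frac1{1+\nu}<\delta\le1$, $\mu>0$, and: (i) $f$ is $\nu$-paraconvex with constant $\rho$ on an open convex set $X'$ with $X\subseteq X'\subseteq\operatorname{dom}(f)$, i.e. $f(\lambda x+(1-\lambda)y)\le\lambda f(x)+(1-\lambda)f(y)+\rho\min\{\lambda,1-\lambda\}\|x-y\|^{1+\nu}$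 for all $x,y\in X'$, $\lambda\in[0,1]$ (consequently $f$ is locally Lipschitz on $X'$); (ii) Hölderian error bound: $\mu\operatorname{dist}^{1/\delta}(x;\mathcal{X}^* )\le f(x)-f^*$ for all $x\in X$. For $\gamma\in(0,1]$ let $\mathcal{T}_\gamma=\big\{x\in X:\operatorname{dist}(x;\mathcal{X}^* )<(\gamma\mu/\rho)^{\delta/(\delta(1+\nu)-1)}\big\}$. Let $L=\sup\{\|\zeta\|:\zeta\in\partial f(x),\ x\in\mathcal{T}_1\}$, with $0<L<\infty$. Projected subgradient method with step-sizes $\alpha_k$: from the initial point, at each iteration choose any $\zeta_k\in\partial f(x_k)$ and set $x_{k+1}=\operatorname{proj}_X\big(x_k-\alpha_k\zeta_k/\|\zeta_k\|\big)$; if $\zeta_k=0$, set $x_{k+1}=x_k$. *)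

theory Defs
  imports "HOL-Analysis.Analysis"
begin

text \<open>Functions \<open>\<real>\<^sup>n \<rightarrow> \<real> \<union> {+\<infinity>}\<close> are rendered as \<^typ>\<open>ereal\<close>-valued
  functions that do not take the value \<open>-\<infinity>\<close>.\<close>

definition proper_fun :: "('a \<Rightarrow> ereal) \<Rightarrow> bool" where
  "proper_fun f \<longleftrightarrow> (\<forall>x. f x \<noteq> -\<infinity>) \<and> (\<exists>x. f x < \<infinity>)"

definition edom :: "('a \<Rightarrow> ereal) \<Rightarrow> 'a set" where
  "edom f = {x. f x < \<infinity>}"

definition argmin_set :: "('a \<Rightarrow> ereal) \<Rightarrow> 'a set \<Rightarrow> 'a set" where
  "argmin_set f X = {x. is_arg_min f (\<lambda>y. y \<in> X) x}"

definition paraconvex_on ::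
    "'a::real_normed_vector set \<Rightarrow> real \<Rightarrow> real \<Rightarrow> ('a \<Rightarrow> ereal) \<Rightarrow> bool" where
  "paraconvex_on S \<nu> \<rho> f \<longleftrightarrow>
     (\<forall>x\<in>S. \<forall>y\<in>S. \<forall>l\<in>{0..1}.
        f (l *\<^sub>R x + (1 - l) *\<^sub>R y)
          \<le> ereal l * f x + ereal (1 - l) * f y
             + ereal (\<rho> * min l (1 - l) * norm (x - y) powr (1 + \<nu>)))"

text \<open>Clarke's generalized directional derivative
  \<open>f\<^sup>\<circ>(x;v) = limsup (f (y + t v) - f y) / t\<close> as \<open>y \<rightarrow> x\<close> and \<open>t \<down> 0\<close>,
  and the subdifferential \<open>{\<zeta>. \<forall>v. \<langle>\<zeta>,v\<rangle> \<le> f\<^sup>\<circ>(x;v)}\<close>.  This is the Clarke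
  subdifferential at points near which \<open>f\<close> is finite and Lipschitz; it is not meant to be
  used at other points (where the difference quotients may involve \<open>\<infinity> - \<infinity>\<close>).\<close>

definition clarke_dderiv :: "('a::euclidean_space \<Rightarrow> ereal) \<Rightarrow> 'a \<Rightarrow> 'a \<Rightarrow> ereal" where
  "clarke_dderiv f x v =
     Limsup (nhds x \<times>\<^sub>F at_right (0::real)) (\<lambda>(y, t). (f (y + t *\<^sub>R v) - f y) / ereal t)"

definition clarke_subdiff :: "('a::euclidean_space \<Rightarrow> ereal) \<Rightarrow> 'a \<Rightarrow> 'a set" where
  "clarke_subdiff f x = {\<zeta>. \<forall>v. ereal (\<zeta> \<bullet> v) \<le> clarke_dderiv f x v}"

definition tube ::
    "('a::euclidean_space \<Rightarrow> ereal) \<Rightarrow> 'a set \<Rightarrow> real \<Rightarrow> real \<Rightarrow> real \<Rightarrow> real \<Rightarrow> real \<Rightarrow> 'a set" where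
  "tube f X \<rho> \<nu> \<delta> \<mu> \<gamma> =
     {x\<in>X. infdist x (argmin_set f X) < (\<gamma> * \<mu> / \<rho>) powr (\<delta> / (\<delta> * (1 + \<nu>) - 1))}"

text \<open>The iterates are \<open>x 1, x 2, \<dots>\<close>; the value \<open>x 0\<close> is irrelevant.  \<open>\<zeta> k\<close> is the
  subgradient chosen at iteration \<open>k\<close>.\<close>

definition projected_subgradient ::
    "('a::euclidean_space \<Rightarrow> ereal) \<Rightarrow> 'a set \<Rightarrow> (nat \<Rightarrow> real) \<Rightarrow> (nat \<Rightarrow> 'a) \<Rightarrow> (nat \<Rightarrow> 'a) \<Rightarrow> bool"
where
  "projected_subgradient f X \<alpha> \<zeta> x \<longleftrightarrow>
     (\<forall>k\<ge>1. \<zeta> k \<in> clarke_subdiff f (x k) \<and>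
        x (Suc k) = (if \<zeta> k = 0 then x k
                     else closest_point X (x k - (\<alpha> k / norm (\<zeta> k)) *\<^sub>R \<zeta> k)))"

end

theory Submission
  imports Defs
begin

text \<open>
  Write \<open>d\<close> for the distance of an iterate to the set \<open>\<X>\<^sup>*\<close> of minimizers.
  At a point of the tube, compare with a nearest minimizer \<open>p\<close>.  Paraconvexity makes every
  Clarke subgradient \<open>\<zeta>\<close> at \<open>x\<close> an affine minorant up to the error \<open>\<rho> d\<^bsup>1+\<nu>\<^esup>\<close>
  (\<open>clarke_subgradient_inequality\<close>), and the radius of the tube with \<open>\<gamma> = 1/2\<close> is exactly
  the distance below which the error bound makes that error at most half of the gap
  \<open>f x - f\<^sup>*\<close> (\<open>holder_error_absorbs_curvature\<close>).  Hence
  \<open>\<langle>\<zeta>, x - p\<rangle> \<ge> (f x - f\<^sup>*) / 2\<close>: moving against \<open>\<zeta>\<close> approaches \<open>p\<close> as it would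
  for a convex function, with half the rate.

  A normalized step of length \<open>\<alpha>\<close> followed by the projection, which is nonexpansive and fixes \<open>p\<close>,
  therefore changes the squared distance by at most
  \<open>\<alpha>\<^sup>2 - \<alpha> (f x - f\<^sup>*) / \<parallel>\<zeta>\<parallel>\<close>.  Since \<open>\<parallel>\<zeta>\<parallel> \<le> L\<close> in the tube, a gap above \<open>2 L \<alpha>\<close>
  means a loss of at least \<open>\<alpha>\<^sup>2\<close>; in particular the next iterate is still in the tube.
  If the gap stayed above \<open>2 L \<alpha>\<close> for \<open>k\<close> iterations, \<open>d\<^sup>2\<close> would have dropped by
  \<open>k \<alpha>\<^sup>2\<close> from a starting value below the squared radius of the tube; for the stated \<open>k\<close> it
  would then be negative.

  The subgradient inequality is a limit of difference quotients at base points tending to \<open>x\<close>,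
  so it rests on continuity of paraconvex functions in finite dimension
  (\<open>paraconvex_imp_continuous\<close>), which also gives closedness of the set of minimizers and with it
  the existence of \<open>p\<close>.
\<close>

section \<open>Continuity of paraconvex functions\<close>

lemma paraconvex_onD:
  assumes "paraconvex_on S \<nu> \<rho> (\<lambda>x. ereal (g x))" "x \<in> S" "y \<in> S" "0 \<le> l" "l \<le> 1"
  shows "g (l *\<^sub>R x + (1 - l) *\<^sub>R y)
           \<le> l * g x + (1 - l) * g y + \<rho> * min l (1 - l) * norm (x - y) powr (1 + \<nu>)"
  using assms unfolding paraconvex_on_def by fastforce

lemma paraconvex_on_cong:
  assumes "convex S" "\<And>x. x \<in> S \<Longrightarrow> f x = h x"
  shows "paraconvex_on S \<nu> \<rho> f \<longleftrightarrow> paraconvex_on S \<nu> \<rho> h"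
  using assms unfolding paraconvex_on_def
  by (intro ball_cong refl) (auto simp: convexD_alt add.commute convex_def)

text \<open>Adding a vertex \<open>a\<close> to a polytope joins \<open>a\<close> to the old points by segments, and along a segment of
  bounded length paraconvexity exceeds the larger of the end values by a bounded amount only.\<close>

lemma paraconvex_bounded_above_on_convex_hull:
  fixes g :: "'a::real_normed_vector \<Rightarrow> real"
  assumes para: "paraconvex_on S \<nu> \<rho> (\<lambda>x. ereal (g x))"
    and "finite V" "convex hull V \<subseteq> S" "0 \<le> \<rho>" "0 \<le> 1 + \<nu>"
  shows "bdd_above (g ` (convex hull V))"
  using assms(2,3)
proof (induction V rule: finite_induct)
  case empty
  then show ?case by simp
next
  case (insert a V)
  have sub: "convex hull V \<subseteq> convex hull insert a V"
    by (intro hull_mono) auto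
  show ?case
  proof (cases "V = {}")
    case True
    then show ?thesis by simp
  next
    case False
    obtain M where M: "\<And>z. z \<in> convex hull V \<Longrightarrow> g z \<le> M"
      using insert.IH insert.prems sub by (force simp: bdd_above_def)
    have "bounded (convex hull insert a V)"
      using insert.hyps by (simp add: bounded_convex_hull finite_imp_bounded)
    then obtain B where B: "\<And>y z. y \<in> convex hull insert a V \<Longrightarrow> z \<in> convex hull insert a V
        \<Longrightarrow> dist y z \<le> B"
      unfolding bounded_two_points by blast
    show ?thesis
    proof (rule bdd_aboveI2)
      fix z assume "z \<in> convex hull insert a V"
      then obtain u v b where uv: "0 \<le> u" "0 \<le> v" "u + v = 1" "b \<in> convex hull V"
        "z = u *\<^sub>R a + v *\<^sub>R b"
        using False by (auto simp: convex_hull_insert)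
      then have v: "v = 1 - u" by simp
      have a: "a \<in> convex hull insert a V" by (simp add: hull_inc)
      have b: "b \<in> convex hull insert a V" using uv sub by blast
      have "g z \<le> u * g a + v * g b + \<rho> * min u v * norm (a - b) powr (1 + \<nu>)"
        using paraconvex_onD[OF para, of a b u] a b insert.prems uv unfolding v by auto
      also have "u * g a \<le> 1 * \<bar>g a\<bar>"
        using uv by (smt (verit) mult_left_le_one_le mult_left_mono)
      also have "v * g b \<le> 1 * \<bar>M\<bar>"
        using uv M[of b] by (smt (verit) mult_left_le_one_le mult_left_mono)
      also have "\<rho> * min u v * norm (a - b) powr (1 + \<nu>) \<le> \<rho> * 1 * B powr (1 + \<nu>)"
        using uv B[OF a b] assms
        by (intro mult_mono powr_mono2) (auto simp: dist_norm)
      finally show "g z \<le> 1 * \<bar>g a\<bar> + 1 * \<bar>M\<bar> + \<rho> * 1 * B powr (1 + \<nu>)"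
        by simp
    qed
  qed
qed

lemma paraconvex_locally_bounded_above:
  fixes g :: "'a::euclidean_space \<Rightarrow> real"
  assumes "paraconvex_on S \<nu> \<rho> (\<lambda>x. ereal (g x))" "open S" "x \<in> S" "0 \<le> \<rho>" "0 \<le> 1 + \<nu>"
  obtains r M where "r > 0" "ball x r \<subseteq> S" "\<And>z. z \<in> ball x r \<Longrightarrow> g z \<le> M"
proof -
  obtain a b where ab: "x \<in> box a b" "cbox a b \<subseteq> S"
    using open_contains_cbox[OF assms(2,3)] by metis
  obtain V where V: "finite V" "cbox a b = convex hull V"
    using polytope_interval[of a b] by (auto simp: polytope_def)
  then obtain M where M: "\<And>z. z \<in> cbox a b \<Longrightarrow> g z \<le> M"
    using paraconvex_bounded_above_on_convex_hull[OF assms(1), of V] ab assms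
    by (auto simp: bdd_above_def)
  obtain r where "r > 0" "ball x r \<subseteq> box a b"
    using ab open_box open_contains_ball by metis
  with M ab box_subset_cbox[of a b] show ?thesis
    by (intro that[of r M]) blast+
qed

text \<open>As for convex functions, a local upper bound yields a two-sided estimate
  \<open>\<bar>g z - g x\<bar> \<le> K * dist x z\<close>: on the line through \<open>x\<close> and \<open>z\<close>, the point \<open>z\<close> lies between
  \<open>x\<close> and a point \<open>w\<close> at distance \<open>r\<close>, and \<open>x\<close> lies between \<open>z\<close> and the opposite point \<open>w'\<close>.
  In both cases the far point has a weight of order \<open>dist x z\<close>, and the factor
  \<open>min l (1 - l)\<close> makes the paraconvexity error of that order as well.\<close>

lemma paraconvex_imp_continuous:
  fixes g :: "'a::euclidean_space \<Rightarrow> real"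
  assumes para: "paraconvex_on S \<nu> \<rho> (\<lambda>x. ereal (g x))"
    and "open S" "x \<in> S" "0 \<le> \<rho>" "0 \<le> 1 + \<nu>"
  shows "isCont g x"
proof -
  obtain r0 M where r0: "r0 > 0" "ball x r0 \<subseteq> S" "\<And>z. z \<in> ball x r0 \<Longrightarrow> g z \<le> M"
    using paraconvex_locally_bounded_above[OF assms] by blast
  define r where "r = r0 / 2"
  have r: "r > 0" using r0 by (simp add: r_def)
  have inb: "w \<in> S" "g w \<le> M" if "dist x w \<le> r" for w
    using that r0 r by (auto simp: r_def subset_iff)
  define C where "C = \<rho> * (2 * r) powr (1 + \<nu>)"
  define K where "K = (M - g x + C) / r"
  have near: "norm (g z - g x) \<le> K * dist x z" if z: "dist x z \<le> r" for z
  proof (cases "z = x")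
    case False
    define l where "l = dist x z / r"
    have l: "0 < l" "l \<le> 1" using False z r by (auto simp: l_def)
    have Kl: "K * dist x z = l * (M - g x + C)" by (simp add: K_def l_def)
    define w where "w = x + (1 / l) *\<^sub>R (z - x)"
    define w' where "w' = x - (1 / l) *\<^sub>R (z - x)"
    have nw: "norm ((1 / l) *\<^sub>R (z - x)) = r"
      using False r by (simp add: l_def dist_norm norm_minus_commute)
    have w: "dist x w \<le> r" "dist x w' \<le> r"
      using nw by (simp_all add: w_def w'_def dist_norm)
    have "norm (w - x) powr (1 + \<nu>) \<le> (2 * r) powr (1 + \<nu>)"
      using nw r assms by (intro powr_mono2) (auto simp: w_def)
    then have c1: "\<rho> * norm (w - x) powr (1 + \<nu>) \<le> C"
      unfolding C_def using assms by (intro mult_left_mono)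
    have "norm (z - w') \<le> 2 * r"
    proof -
      have "norm (z - w') \<le> dist x z + dist x w'"
        by (metis dist_commute dist_norm dist_triangle)
      then show ?thesis using z w by simp
    qed
    then have "norm (z - w') powr (1 + \<nu>) \<le> (2 * r) powr (1 + \<nu>)"
      using r assms by (intro powr_mono2) auto
    then have c2: "\<rho> * norm (z - w') powr (1 + \<nu>) \<le> C"
      unfolding C_def using assms by (intro mult_left_mono)
    have "z = l *\<^sub>R w + (1 - l) *\<^sub>R x"
      using l by (simp add: w_def algebra_simps)
    then have "g z \<le> l * g w + (1 - l) * g x + \<rho> * min l (1 - l) * norm (w - x) powr (1 + \<nu>)"
      using paraconvex_onD[OF para, of w x l] inb[OF w(1)] assms l by simp
    also have "\<rho> * min l (1 - l) * norm (w - x) powr (1 + \<nu>) \<le> \<rho> * l * norm (w - x) powr (1 + \<nu>)"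
      using assms l by (intro mult_right_mono mult_left_mono) auto
    also have "\<dots> \<le> l * C"
      using mult_left_mono[OF c1, of l] l by (simp add: mult_ac)
    also have "l * g w \<le> l * M" using inb[OF w(1)] l by simp
    finally have up: "g z - g x \<le> l * (M - g x + C)" by (simp add: algebra_simps)
    \<comment> \<open>the weight of \<open>z\<close> when \<open>x\<close> is written as a convex combination of \<open>z\<close> and \<open>w'\<close>\<close>
    define m where "m = 1 / (1 + l)"
    have m: "0 < m" "m \<le> 1" "1 - m = l * m" "m * (1 + l) = 1"
      using l by (auto simp: m_def field_simps)
    have "m *\<^sub>R z + (l * m) *\<^sub>R w' = (m * (1 + l)) *\<^sub>R x"
      using l by (simp add: w'_def algebra_simps)
    then have "g x \<le> m * g z + (l * m) * g w'
                 + \<rho> * min m (l * m) * norm (z - w') powr (1 + \<nu>)"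
      using paraconvex_onD[OF para, of z w' m] inb[OF w(2)] inb[OF z] m
      by simp
    also have "\<rho> * min m (l * m) * norm (z - w') powr (1 + \<nu>)
                 \<le> \<rho> * (l * m) * norm (z - w') powr (1 + \<nu>)"
      using assms by (intro mult_right_mono mult_left_mono) auto
    also have "\<dots> \<le> (l * m) * C"
      using mult_left_mono[OF c2, of "l * m"] l m by (simp add: mult_ac)
    also have "(l * m) * g w' \<le> (l * m) * M" using inb[OF w(2)] l m by simp
    finally have "g x \<le> m * (g z + l * M + l * C)" by (simp add: algebra_simps)
    then have "(1 + l) * g x \<le> g z + l * M + l * C"
      using l by (simp add: m_def field_simps)
    then have "g x - g z \<le> l * (M - g x + C)" by (simp add: algebra_simps)
    with up show ?thesis by (simp add: Kl)
  qed simp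
  have "((\<lambda>z. g z - g x) \<longlongrightarrow> 0) (at x)"
  proof (rule Lim_null_comparison)
    show "\<forall>\<^sub>F z in at x. norm (g z - g x) \<le> K * dist x z"
      using r near by (auto simp: eventually_at dist_commute intro!: exI[of _ r])
    have "((\<lambda>z. K * dist x z) \<longlongrightarrow> K * dist x x) (at x)"
      by (intro tendsto_intros)
    then show "((\<lambda>z. K * dist x z) \<longlongrightarrow> 0) (at x)" by simp
  qed
  then show ?thesis
    by (simp add: isCont_def LIM_zero_iff)
qed

section \<open>Subgradients of paraconvex functions\<close>

text \<open>With \<open>v = y - x\<close>, paraconvexity between a base point \<open>z\<close> near \<open>x\<close> and \<open>z + v\<close>, divided by \<open>t\<close>,
  bounds the difference quotient at \<open>z\<close> in direction \<open>v\<close> by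
  \<open>g (z + v) - g z + \<rho> \<parallel>v\<parallel>\<^bsup>1+\<nu>\<^esup>\<close>.  The bound is uniform in \<open>t\<close> because
  \<open>min t (1 - t) \<le> t\<close>, and it is continuous in \<open>z\<close>.  The end point has to move along
  with \<open>z\<close>, since the direction is fixed in Clarke's derivative.\<close>

lemma clarke_subgradient_inequality:
  fixes f :: "'a::euclidean_space \<Rightarrow> ereal"
  assumes para: "paraconvex_on S \<nu> \<rho> (\<lambda>x. ereal (g x))"
    and fg: "\<And>z. z \<in> S \<Longrightarrow> f z = ereal (g z)"
    and S: "open S" "convex S" and xy: "x \<in> S" "y \<in> S" and "0 \<le> \<rho>" "0 \<le> 1 + \<nu>"
    and \<zeta>: "\<zeta> \<in> clarke_subdiff f x"
  shows "g x + \<zeta> \<bullet> (y - x) - \<rho> * norm (y - x) powr (1 + \<nu>) \<le> g y"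
proof -
  define v where "v = y - x"
  define R where "R = \<rho> * norm v powr (1 + \<nu>)"
  have "\<zeta> \<bullet> v \<le> c" if c: "g y - g x + R < c" for c
  proof -
    have cont: "isCont g z" if "z \<in> S" for z
      using paraconvex_imp_continuous[OF para S(1) that] assms by blast
    have "isCont (\<lambda>z. g (z + v) - g z + R) x"
      using cont[OF xy(1)] cont[OF xy(2)]
      by (intro continuous_intros isCont_o2[of _ "\<lambda>z. z + v" g]) (auto simp: v_def)
    then have "((\<lambda>z. g (z + v) - g z + R) \<longlongrightarrow> g y - g x + R) (nhds x)"
      using tendsto_at_iff_tendsto_nhds[of "\<lambda>z. g (z + v) - g z + R" x]
      by (simp add: isCont_def v_def)
    then have e1: "\<forall>\<^sub>F z in nhds x. g (z + v) - g z + R < c"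
      using c by (rule order_tendstoD)
    have e2: "\<forall>\<^sub>F z in nhds x. z \<in> S"
      using S xy by (auto simp: eventually_nhds)
    have "((\<lambda>z. z + v) \<longlongrightarrow> x + v) (nhds x)"
      by (intro tendsto_intros filterlim_ident)
    then have e3: "\<forall>\<^sub>F z in nhds x. z + v \<in> S"
      by (rule topological_tendstoD) (use S xy in \<open>auto simp: v_def\<close>)
    have e4: "\<forall>\<^sub>F t in at_right (0::real). 0 < t \<and> t < 1"
      by (auto simp: eventually_at_right[of 0 1] intro!: exI[of _ 1])
    have "\<forall>\<^sub>F (z, t) in nhds x \<times>\<^sub>F at_right 0. (f (z + t *\<^sub>R v) - f z) / ereal t \<le> ereal c"
      unfolding eventually_prod_filter
    proof (intro exI conjI allI impI)
      show "\<forall>\<^sub>F z in nhds x. g (z + v) - g z + R < c \<and> z \<in> S \<and> z + v \<in> S"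
        using e1 e2 e3 by eventually_elim auto
      show "\<forall>\<^sub>F t in at_right (0::real). 0 < t \<and> t < 1" by (rule e4)
    next
      fix z and t :: real
      assume z: "g (z + v) - g z + R < c \<and> z \<in> S \<and> z + v \<in> S" and t: "0 < t \<and> t < 1"
      have eq: "z + t *\<^sub>R v = t *\<^sub>R (z + v) + (1 - t) *\<^sub>R z"
        by (simp add: algebra_simps)
      have mem: "z + t *\<^sub>R v \<in> S"
        unfolding eq using z t S by (intro convexD) auto
      have "g (z + t *\<^sub>R v) \<le> t * g (z + v) + (1 - t) * g z
              + \<rho> * min t (1 - t) * norm v powr (1 + \<nu>)"
        using paraconvex_onD[OF para, of "z + v" z t] z t unfolding eq by simp
      also have "\<rho> * min t (1 - t) * norm v powr (1 + \<nu>) \<le> \<rho> * t * norm v powr (1 + \<nu>)"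
        using assms by (intro mult_right_mono mult_left_mono) auto
      finally have "g (z + t *\<^sub>R v) - g z \<le> t * (g (z + v) - g z + R)"
        by (simp add: R_def algebra_simps)
      also have "\<dots> \<le> t * c" using z t by (intro mult_left_mono) auto
      finally have "(g (z + t *\<^sub>R v) - g z) / t \<le> c"
        using t by (simp add: field_simps)
      then show "case (z, t) of (z, t) \<Rightarrow> (f (z + t *\<^sub>R v) - f z) / ereal t \<le> ereal c"
        using z t mem by (simp add: fg)
    qed
    then have "clarke_dderiv f x v \<le> ereal c"
      unfolding clarke_dderiv_def by (intro Limsup_bounded) (simp add: case_prod_unfold)
    moreover have "ereal (\<zeta> \<bullet> v) \<le> clarke_dderiv f x v"
      using \<zeta> by (simp add: clarke_subdiff_def)
    ultimately show ?thesis using order_trans ereal_less_eq(3) by blast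
  qed
  then have "\<zeta> \<bullet> v \<le> g y - g x + R" by (rule dense_ge)
  then show ?thesis by (simp add: v_def R_def)
qed

section \<open>Progress of one step inside the tube\<close>

text \<open>The quotient of the two powers of \<open>d\<close> is \<open>d\<close> to the power
  \<open>q = (\<delta> (1 + \<nu>) - 1) / \<delta> > 0\<close>, and the radius is the value at which \<open>d powr q\<close>
  reaches \<open>\<mu> / (2 \<rho>)\<close>.\<close>

lemma holder_error_absorbs_curvature:
  fixes d \<mu> \<rho> \<delta> \<nu> :: real
  assumes "0 < \<mu>" "0 < \<rho>" "0 < \<delta>" "0 < \<delta> * (1 + \<nu>) - 1" "0 \<le> d"
    and d: "d \<le> (\<mu> / (2 * \<rho>)) powr (\<delta> / (\<delta> * (1 + \<nu>) - 1))"
  shows "\<rho> * d powr (1 + \<nu>) \<le> \<mu> / 2 * d powr (1 / \<delta>)"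
proof -
  define q where "q = (\<delta> * (1 + \<nu>) - 1) / \<delta>"
  have q: "0 < q" "1 + \<nu> = 1 / \<delta> + q" "\<delta> / (\<delta> * (1 + \<nu>) - 1) * q = 1"
    unfolding q_def using assms(3,4) by (simp, simp add: diff_divide_distrib, simp)
  have "d powr q \<le> ((\<mu> / (2 * \<rho>)) powr (\<delta> / (\<delta> * (1 + \<nu>) - 1))) powr q"
    using assms q by (intro powr_mono2) auto
  also have "\<dots> = \<mu> / (2 * \<rho>)"
    unfolding powr_powr q(3) using assms by simp
  finally have "\<rho> * d powr q \<le> \<mu> / 2"
    using assms by (simp add: field_simps)
  then have "d powr (1 / \<delta>) * (\<rho> * d powr q) \<le> d powr (1 / \<delta>) * (\<mu> / 2)"
    by (intro mult_left_mono) auto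
  then show ?thesis by (simp add: q(2) powr_add mult_ac)
qed

lemma projected_step_distance:
  fixes y p \<zeta> :: "'a::euclidean_space"
  assumes "closed X" "convex X" "p \<in> X" "\<zeta> \<noteq> 0"
  shows "(dist (closest_point X (y - (\<alpha> / norm \<zeta>) *\<^sub>R \<zeta>)) p)\<^sup>2
           \<le> (dist y p)\<^sup>2 - 2 * \<alpha> * (\<zeta> \<bullet> (y - p)) / norm \<zeta> + \<alpha>\<^sup>2"
proof -
  let ?w = "(\<alpha> / norm \<zeta>) *\<^sub>R \<zeta>"
  have "dist (closest_point X (y - ?w)) p \<le> dist (y - ?w) p"
    using closest_point_lipschitz[of X "y - ?w" p] closest_point_self[of p X] assms by auto
  then have "(dist (closest_point X (y - ?w)) p)\<^sup>2 \<le> (norm ((y - p) - ?w))\<^sup>2"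
    by (simp add: power_mono dist_norm algebra_simps)
  also have "\<dots> = (norm (y - p))\<^sup>2 - 2 * (?w \<bullet> (y - p)) + (norm ?w)\<^sup>2"
    unfolding power2_norm_eq_inner by (simp only: inner_diff_left inner_diff_right inner_commute) simp
  finally show ?thesis using assms by (simp add: dist_norm)
qed

section \<open>The complexity bound\<close>

theorem theorem4p5:
  fixes f :: "real ^ 'n \<Rightarrow> ereal"
    and X X' :: "(real ^ 'n) set"
    and fstar :: ereal
    and \<rho> \<nu> \<delta> \<mu> L \<alpha> :: real
    and x \<zeta> :: "nat \<Rightarrow> real ^ 'n"
  assumes "proper_fun f"
    and "X \<noteq> {}" and "closed X" and "convex X" and "X \<subseteq> edom f"
    and "argmin_set f X \<noteq> {}"
    and "fstar = (INF z\<in>X. f z)"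
    and "\<rho> > 0" and "0 < \<nu>" and "\<nu> \<le> 1" and "1 / (1 + \<nu>) < \<delta>" and "\<delta> \<le> 1" and "\<mu> > 0"
    and "open X'" and "convex X'" and "X \<subseteq> X'" and "X' \<subseteq> edom f"
    and "paraconvex_on X' \<nu> \<rho> f"
    and "\<forall>z\<in>X. ereal (\<mu> * infdist z (argmin_set f X) powr (1 / \<delta>)) \<le> f z - fstar"
    and "ereal L = (SUP \<xi>\<in>(\<Union>z\<in>tube f X \<rho> \<nu> \<delta> \<mu> 1. clarke_subdiff f z). ereal (norm \<xi>))"
    and "L > 0"
    and "projected_subgradient f X (\<lambda>k. \<alpha>) \<zeta> x"
    and "x 1 \<in> tube f X \<rho> \<nu> \<delta> \<mu> (1 / 2)"
    and "0 < \<alpha>"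
    and "\<alpha> < min 1 (min 1 (\<mu> / L) * (\<mu> / (2 * \<rho>)) powr (1 / (\<delta> * (1 + \<nu>) - 1)))"
  shows "\<forall>k::nat. real k \<ge> 1 / \<alpha>\<^sup>2 * (\<mu> / (2 * \<rho>)) powr (2 * \<delta> / (\<delta> * (1 + \<nu>) - 1)) \<longrightarrow>
           0 \<le> Min ((\<lambda>i. f (x i)) ` {1..k}) - fstar \<and>
           Min ((\<lambda>i. f (x i)) ` {1..k}) - fstar \<le> ereal (2 * L * \<alpha>)"
proof -
  let ?A = "argmin_set f X" and ?R = "(\<mu> / (2 * \<rho>)) powr (\<delta> / (\<delta> * (1 + \<nu>) - 1))"
  define g where "g = (\<lambda>z. real_of_ereal (f z))"
  have fg: "f z = ereal (g z)" if "z \<in> X'" for z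
  proof -
    have "f z \<noteq> -\<infinity>" "f z < \<infinity>"
      using that \<open>proper_fun f\<close> \<open>X' \<subseteq> edom f\<close> by (auto simp: proper_fun_def edom_def)
    then show ?thesis by (cases "f z") (auto simp: g_def)
  qed
  have para: "paraconvex_on X' \<nu> \<rho> (\<lambda>z. ereal (g z))"
    using \<open>paraconvex_on X' \<nu> \<rho> f\<close> paraconvex_on_cong[OF \<open>convex X'\<close>, of f "\<lambda>z. ereal (g z)"] fg
    by blast
  have X: "z \<in> X'" if "z \<in> X" for z using that \<open>X \<subseteq> X'\<close> by blast
  obtain m where m: "m \<in> ?A" using \<open>argmin_set f X \<noteq> {}\<close> by blast
  then have mX: "m \<in> X" and mmin: "\<And>z. z \<in> X \<Longrightarrow> f m \<le> f z"
    by (auto simp: argmin_set_def is_arg_min_def not_less)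
  have fstar: "fstar = ereal (g m)"
    using assms(7) mX mmin fg[OF X[OF mX]] by (metis INF_eqI INF_lower antisym le_INF_iff)
  have A: "?A = {z \<in> X. g z = g m}"
    using mX mmin fg X unfolding argmin_set_def is_arg_min_def
    by (auto simp: not_less) (metis antisym ereal_less_eq(3) not_le)+
  have "continuous_on X g"
    using paraconvex_imp_continuous[OF para \<open>open X'\<close>] X assms(8,9)
    by (intro continuous_at_imp_continuous_on) auto
  then have "closed (X \<inter> g -` {g m})"
    using \<open>closed X\<close> by (intro continuous_closed_preimage) auto
  then have clA: "closed ?A" unfolding A by (simp add: vimage_def Int_def)
  have dpos: "0 < \<delta>" "0 < \<delta> * (1 + \<nu>) - 1"
  proof -
    show "0 < \<delta>" using assms(9,11) by (smt (verit) divide_pos_pos)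
    show "0 < \<delta> * (1 + \<nu>) - 1" using assms(9,11) by (simp add: field_simps)
  qed
  have xX: "x i \<in> X" if "i \<ge> 1" for i
    using that
  proof (induction i rule: nat_induct_at_least)
    case base
    then show ?case using assms(23) by (simp add: tube_def)
  next
    case (Suc i)
    then show ?case
      using assms(22) closest_point_in_set[OF \<open>closed X\<close> \<open>X \<noteq> {}\<close>]
      by (auto simp: projected_subgradient_def)
  qed
  define d where "d = (\<lambda>i. infdist (x i) ?A)"
  have d0: "0 \<le> d i" for i by (simp add: d_def infdist_nonneg)
  have step: "(d (Suc i))\<^sup>2 \<le> (d i)\<^sup>2 - \<alpha>\<^sup>2"
    if i: "i \<ge> 1" and dR: "d i < ?R" and gap: "g (x i) - g m > 2 * L * \<alpha>" for i
  proof -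
    obtain p where p: "p \<in> ?A" "d i = dist (x i) p"
      using infdist_attains_inf[OF clA] m unfolding d_def by blast
    have pX: "p \<in> X" "g p = g m" using p A by auto
    have sub: "\<zeta> i \<in> clarke_subdiff f (x i)"
      using assms(22) i by (simp add: projected_subgradient_def)
    have "?R \<le> (1 * \<mu> / \<rho>) powr (\<delta> / (\<delta> * (1 + \<nu>) - 1))"
      using dpos assms(8,13) by (intro powr_mono2) (auto simp: field_simps)
    then have "x i \<in> tube f X \<rho> \<nu> \<delta> \<mu> 1"
      using dR xX[OF i] by (simp add: tube_def d_def)
    then have "ereal (norm (\<zeta> i)) \<le> ereal L"
      unfolding assms(20) using sub by (intro SUP_upper) auto
    then have L: "norm (\<zeta> i) \<le> L" by simp
    have "\<rho> * d i powr (1 + \<nu>) \<le> \<mu> / 2 * d i powr (1 / \<delta>)"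
      using holder_error_absorbs_curvature[of \<mu> \<rho> \<delta> \<nu> "d i"] dpos assms(8,13) d0 dR by simp
    moreover have "\<mu> * d i powr (1 / \<delta>) \<le> g (x i) - g m"
      using assms(19) xX[OF i] fg[OF X[OF xX[OF i]]] by (auto simp: fstar d_def)
    moreover have "g (x i) + \<zeta> i \<bullet> (p - x i) - \<rho> * d i powr (1 + \<nu>) \<le> g p"
      using clarke_subgradient_inequality[OF para fg \<open>open X'\<close> \<open>convex X'\<close> X[OF xX[OF i]] X[OF pX(1)] _ _ sub]
        assms(8,9) by (simp add: p(2) dist_norm norm_minus_commute)
    ultimately have inner: "(g (x i) - g m) / 2 \<le> \<zeta> i \<bullet> (x i - p)"
      using pX(2) by (simp add: inner_diff_right)
    \<comment> \<open>A zero subgradient would make the gap nonpositive, so the step is a genuine one.\<close>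
    have "0 < L * \<alpha>" using \<open>0 < L\<close> \<open>0 < \<alpha>\<close> by simp
    then have nz: "\<zeta> i \<noteq> 0" using inner gap by auto
    have "norm (\<zeta> i) * \<alpha> \<le> L * \<alpha>" using L \<open>0 < \<alpha>\<close> by simp
    also have "\<dots> \<le> \<zeta> i \<bullet> (x i - p)" using inner gap by simp
    finally have "\<alpha> \<le> \<zeta> i \<bullet> (x i - p) / norm (\<zeta> i)" using nz by (simp add: field_simps)
    then have prog: "2 * \<alpha>\<^sup>2 \<le> 2 * \<alpha> * (\<zeta> i \<bullet> (x i - p)) / norm (\<zeta> i)"
      using mult_left_mono[of \<alpha> _ "2 * \<alpha>"] \<open>0 < \<alpha>\<close> by (fastforce simp: power2_eq_square)
    have "d (Suc i) \<le> dist (x (Suc i)) p" unfolding d_def using p(1) by (rule infdist_le)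
    then have "(d (Suc i))\<^sup>2 \<le> (dist (x (Suc i)) p)\<^sup>2" using d0 by (intro power_mono)
    also have "x (Suc i) = closest_point X (x i - (\<alpha> / norm (\<zeta> i)) *\<^sub>R \<zeta> i)"
      using assms(22) i nz by (simp add: projected_subgradient_def)
    also have "(dist \<dots> p)\<^sup>2 \<le> (dist (x i) p)\<^sup>2 - 2 * \<alpha> * (\<zeta> i \<bullet> (x i - p)) / norm (\<zeta> i) + \<alpha>\<^sup>2"
      using \<open>closed X\<close> \<open>convex X\<close> pX(1) nz by (rule projected_step_distance)
    finally show ?thesis using prog p(2) by simp
  qed
  have small_gap: "\<exists>i\<in>{1..k}. g (x i) - g m \<le> 2 * L * \<alpha>" if k: "?R\<^sup>2 \<le> real k * \<alpha>\<^sup>2" for k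
  proof (rule ccontr)
    assume neg: "\<not> ?thesis"
    have d1: "d 1 < ?R" using assms(23) by (simp add: tube_def d_def)
    have "(d (Suc j))\<^sup>2 \<le> (d 1)\<^sup>2 - real j * \<alpha>\<^sup>2" if "j \<le> k" for j
      using that
    proof (induction j)
      case (Suc j)
      then have IH: "(d (Suc j))\<^sup>2 \<le> (d 1)\<^sup>2 - real j * \<alpha>\<^sup>2" by simp
      also have "\<dots> \<le> (d 1)\<^sup>2" by simp
      \<comment> \<open>The distance has not grown, so the iterate is still in the tube and \<open>step\<close> applies.\<close>
      finally have "d (Suc j) \<le> d 1" using d0 by (rule power2_le_imp_le)
      with d1 have "(d (Suc (Suc j)))\<^sup>2 \<le> (d (Suc j))\<^sup>2 - \<alpha>\<^sup>2"
        using neg Suc.prems by (intro step) (auto simp: not_le)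
      with IH show ?case by (simp add: algebra_simps)
    qed simp
    from this[of k] have "(d (Suc k))\<^sup>2 \<le> (d 1)\<^sup>2 - ?R\<^sup>2" using k by simp
    moreover have "(d 1)\<^sup>2 < ?R\<^sup>2" using d1 d0 by (intro power_strict_mono) auto
    ultimately show False by (smt (verit) zero_le_power2)
  qed
  have R2: "(\<mu> / (2 * \<rho>)) powr (2 * \<delta> / (\<delta> * (1 + \<nu>) - 1)) = ?R\<^sup>2"
    by (simp add: power2_eq_square flip: powr_add)
  show ?thesis
  proof (intro allI impI)
    fix k :: nat
    assume "1 / \<alpha>\<^sup>2 * (\<mu> / (2 * \<rho>)) powr (2 * \<delta> / (\<delta> * (1 + \<nu>) - 1)) \<le> real k"
    then have "?R\<^sup>2 \<le> real k * \<alpha>\<^sup>2" using \<open>0 < \<alpha>\<close> unfolding R2 by (simp add: field_simps)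
    then obtain i where i: "i \<in> {1..k}" "g (x i) - g m \<le> 2 * L * \<alpha>" using small_gap by blast
    let ?M = "Min ((\<lambda>i. f (x i)) ` {1..k})"
    have "fstar \<le> ?M"
      using i(1) xX mmin fg[OF X[OF mX]] by (subst Min_ge_iff) (auto simp: fstar)
    then have low: "0 \<le> ?M - fstar" by (simp add: ereal_diff_positive)
    have "?M \<le> f (x i)" using i(1) by (intro Min_le) auto
    then have "?M - fstar \<le> f (x i) - fstar" by (intro ereal_minus_mono) auto
    also have "\<dots> \<le> ereal (2 * L * \<alpha>)" using i fg[OF X[OF xX]] by (simp add: fstar)
    finally show "0 \<le> ?M - fstar \<and> ?M - fstar \<le> ereal (2 * L * \<alpha>)" using low by simp
  qed
qed

end
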